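(* Let $\varkappa$ be an infinite cardinal and let $F_\varkappa$ be the free group in the alphabet $\varkappa$. Then the following statements hold: (i) $F_\varkappa$ can be partitioned into $\varkappa$ left $3$-large subsets; (ii) $F_\varkappa$ can be partitioned into $\varkappa$ $4$-large subsets.
   Context: For a cardinal $\lambda$ (finite cardinals are allowed), a subset $A$ of a group $G$ is called left $\lambda$-large (respectively right $\lambda$-large) if there exists a subset $F \subseteq G$ with $|F| < \lambda$ such that $G = FA$ (respectively $G = AF$), where $FA = \{fa : f \in F,\ a \in A\}$ and $AF = \{af : a \in A,\ f \in F\}$. The set $A$ is called $\lambda$-large if it is both left $\lambda$-large and right $\lambda$-large. The free group in the alphabet $\varkappa$ is the free group on a free generating set of cardinality $\varkappa$. Partitioned into $\varkappa$ subsets of a given kind means: there is a family of exactly $\varkappa$ pairwise disjoint subsets of that kind whose union is the whole group. *)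

theory Defs
  imports "HOL-Algebra.Coset" "HOL-Library.Disjoint_Sets"
begin

unbundle cardinal_syntax

section \<open>Large subsets of groups\<close>

text \<open>
  Cardinals are represented as in the library, by cardinal orders \<open>\<mu>\<close>;
  \<open>|F| <o \<mu>\<close> says that the cardinality of \<open>F\<close> is less than \<open>\<mu>\<close>.  The finite
  cardinal \<open>n\<close> is \<open>natLeq_on n\<close>, the usual order on the natural numbers below \<open>n\<close>.
\<close>

definition left_large :: "('a, 'b) monoid_scheme \<Rightarrow> 'k rel \<Rightarrow> 'a set \<Rightarrow> bool" where
  "left_large G \<mu> A \<longleftrightarrow>
     A \<subseteq> carrier G \<and> (\<exists>F \<subseteq> carrier G. |F| <o \<mu> \<and> carrier G = F <#>\<^bsub>G\<^esub> A)"

definition right_large :: "('a, 'b) monoid_scheme \<Rightarrow> 'k rel \<Rightarrow> 'a set \<Rightarrow> bool" where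
  "right_large G \<mu> A \<longleftrightarrow>
     A \<subseteq> carrier G \<and> (\<exists>F \<subseteq> carrier G. |F| <o \<mu> \<and> carrier G = A <#>\<^bsub>G\<^esub> F)"

definition large :: "('a, 'b) monoid_scheme \<Rightarrow> 'k rel \<Rightarrow> 'a set \<Rightarrow> bool" where
  "large G \<mu> A \<longleftrightarrow> left_large G \<mu> A \<and> right_large G \<mu> A"

text \<open>
  The members of \<open>P\<close> are distinct and, by \<open>partition_on\<close>, nonempty.  For large sets
  nonemptiness is no restriction: the empty set is never large.
\<close>

definition partitioned_into :: "('a, 'b) monoid_scheme \<Rightarrow> 'k rel \<Rightarrow> ('a set \<Rightarrow> bool) \<Rightarrow> bool" where
  "partitioned_into G \<kappa> Q \<longleftrightarrow>
     (\<exists>P. partition_on (carrier G) P \<and> |P| =o \<kappa> \<and> (\<forall>A\<in>P. Q A))"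

section \<open>Free groups\<close>

text \<open>
  The letter \<open>(x, True)\<close> stands for the generator \<open>x\<close> and \<open>(x, False)\<close> for its inverse.
\<close>

type_synonym 'a letter = "'a \<times> bool"

definition inv_letter :: "'a letter \<Rightarrow> 'a letter" where
  "inv_letter l = (fst l, \<not> snd l)"

text \<open>A word is reduced if no two adjacent letters are mutually inverse.\<close>

definition reduced :: "'a letter list \<Rightarrow> bool" where
  "reduced w \<longleftrightarrow> (\<forall>i. Suc i < length w \<longrightarrow> w ! Suc i \<noteq> inv_letter (w ! i))"

fun cons_reduce :: "'a letter \<Rightarrow> 'a letter list \<Rightarrow> 'a letter list" where
  "cons_reduce l [] = [l]"
| "cons_reduce l (m # w) = (if m = inv_letter l then w else l # m # w)"

definition reduce :: "'a letter list \<Rightarrow> 'a letter list" where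
  "reduce w = foldr cons_reduce w []"

definition free_group :: "'a set \<Rightarrow> 'a letter list monoid" where
  "free_group X =
     \<lparr>carrier = {w. reduced w \<and> fst ` set w \<subseteq> X},
      mult = (\<lambda>u v. reduce (u @ v)),
      one = []\<rparr>"

subsection \<open>The group laws and the universal property\<close>

lemma inv_letter_simps [simp]:
  "inv_letter (inv_letter l) = l" "fst (inv_letter l) = fst l" "inv_letter l \<noteq> l"
  by (auto simp: inv_letter_def prod_eq_iff)

lemma reduced_Nil [simp]: "reduced []"
  by (simp add: reduced_def)

lemma reduced_single [simp]: "reduced [l]"
  by (simp add: reduced_def)

lemma reduced_Cons_Cons [simp]:
  "reduced (l # m # w) \<longleftrightarrow> m \<noteq> inv_letter l \<and> reduced (m # w)"
  unfolding reduced_def by (auto simp: nth_Cons split: nat.splits)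

lemma reduced_ConsD: "reduced (l # w) \<Longrightarrow> reduced w"
  by (cases w) auto

lemma reduced_cons_reduce: "reduced w \<Longrightarrow> reduced (cons_reduce l w)"
  by (cases w) (auto dest: reduced_ConsD)

lemma cons_reduce_reduced: "reduced (l # w) \<Longrightarrow> cons_reduce l w = l # w"
  by (cases w) auto

lemma cons_reduce_inv: "reduced w \<Longrightarrow> cons_reduce l (cons_reduce (inv_letter l) w) = w"
  by (cases w) (auto intro: cons_reduce_reduced)

lemma reduced_foldr: "reduced v \<Longrightarrow> reduced (foldr cons_reduce u v)"
  by (induction u) (auto intro: reduced_cons_reduce)

lemma reduced_reduce: "reduced (reduce w)"
  by (simp add: reduce_def reduced_foldr)

lemma reduce_id: "reduced w \<Longrightarrow> reduce w = w"
proof (induction w)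
  case (Cons l w)
  then show ?case
    using reduced_ConsD[OF Cons.prems] by (simp add: reduce_def cons_reduce_reduced)
qed (simp add: reduce_def)

lemma reduce_append: "reduced v \<Longrightarrow> reduce (u @ v) = foldr cons_reduce u v"
  using reduce_id[of v] by (simp add: reduce_def)

lemma foldr_cons_reduce:
  assumes "reduced w"
  shows "foldr cons_reduce (cons_reduce l v) w = cons_reduce l (foldr cons_reduce v w)"
proof (cases v)
  case (Cons m v')
  have "cons_reduce l (cons_reduce (inv_letter l) (foldr cons_reduce v' w)) = foldr cons_reduce v' w"
    using assms by (intro cons_reduce_inv reduced_foldr)
  then show ?thesis using Cons by auto
qed simp

lemma foldr_assoc:
  assumes "reduced w"
  shows "foldr cons_reduce (foldr cons_reduce u v) w = foldr cons_reduce u (foldr cons_reduce v w)"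
  by (induction u) (simp_all add: foldr_cons_reduce assms)

lemma set_cons_reduce: "set (cons_reduce l w) \<subseteq> insert l (set w)"
  by (cases w) auto

lemma set_reduce: "set (reduce w) \<subseteq> set w"
proof (induction w)
  case (Cons l w)
  then show ?case using set_cons_reduce[of l "reduce w"] by (auto simp: reduce_def)
qed (simp add: reduce_def)

lemma foldr_inverse:
  "reduced v \<Longrightarrow> foldr cons_reduce (rev (map inv_letter w)) (foldr cons_reduce w v) = v"
proof (induction w)
  case (Cons l w)
  have "cons_reduce (inv_letter l) (cons_reduce l (foldr cons_reduce w v)) = foldr cons_reduce w v"
    using cons_reduce_inv[OF reduced_foldr[OF Cons.prems], of "inv_letter l"] by simp
  then show ?case using Cons by simp
qed simp

lemma group_free_group: "group (free_group X)"
proof (rule groupI)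
  fix u v assume "u \<in> carrier (free_group X)" "v \<in> carrier (free_group X)"
  then show "u \<otimes>\<^bsub>free_group X\<^esub> v \<in> carrier (free_group X)"
    using set_reduce[of "u @ v"] by (fastforce simp: free_group_def reduced_reduce)
next
  fix u v w
  assume "u \<in> carrier (free_group X)" "v \<in> carrier (free_group X)" "w \<in> carrier (free_group X)"
  then show "u \<otimes>\<^bsub>free_group X\<^esub> v \<otimes>\<^bsub>free_group X\<^esub> w = u \<otimes>\<^bsub>free_group X\<^esub> (v \<otimes>\<^bsub>free_group X\<^esub> w)"
    by (simp add: free_group_def reduce_append reduced_foldr foldr_assoc)
next
  fix u assume u: "u \<in> carrier (free_group X)"
  let ?v = "reduce (rev (map inv_letter u))"
  have "foldr cons_reduce ?v u = foldr cons_reduce (rev (map inv_letter u)) (foldr cons_reduce [] u)"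
    using u unfolding reduce_def by (subst foldr_assoc) (simp_all add: free_group_def)
  also have "\<dots> = []"
    using foldr_inverse[of "[]" u] u reduce_id[of u] by (simp add: free_group_def reduce_def)
  finally have "?v \<otimes>\<^bsub>free_group X\<^esub> u = \<one>\<^bsub>free_group X\<^esub>"
    using u by (simp add: free_group_def reduce_append)
  moreover have "?v \<in> carrier (free_group X)"
    using u set_reduce[of "rev (map inv_letter u)"] by (fastforce simp: free_group_def reduced_reduce)
  ultimately show "\<exists>v \<in> carrier (free_group X). v \<otimes>\<^bsub>free_group X\<^esub> u = \<one>\<^bsub>free_group X\<^esub>"
    by blast
qed (auto simp: free_group_def reduce_id)

lemma free_group_universal:
  fixes H :: "('c, 'd) monoid_scheme" and f :: "'a \<Rightarrow> 'c"
  assumes "group H" and f: "f \<in> X \<rightarrow> carrier H"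
  obtains h where "h \<in> hom (free_group X) H" "\<forall>x\<in>X. h [(x, True)] = f x"
    "\<And>h'. h' \<in> hom (free_group X) H \<Longrightarrow> \<forall>x\<in>X. h' [(x, True)] = f x \<Longrightarrow>
      \<forall>w\<in>carrier (free_group X). h' w = h w"
proof -
  interpret H: group H by fact
  interpret F: group "free_group X" by (rule group_free_group)
  define g where "g l = (if snd l then f (fst l) else inv\<^bsub>H\<^esub> f (fst l))" for l :: "'a letter"
  define h where "h w = foldr (\<lambda>l y. g l \<otimes>\<^bsub>H\<^esub> y) w \<one>\<^bsub>H\<^esub>" for w :: "'a letter list"
  have g: "g l \<in> carrier H" if "fst l \<in> X" for l using that f by (auto simp: g_def)
  have g_inv: "g l \<otimes>\<^bsub>H\<^esub> g (inv_letter l) = \<one>\<^bsub>H\<^esub>" if "fst l \<in> X" for l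
    using that f by (auto simp: g_def inv_letter_def Pi_iff)
  have h_closed: "h w \<in> carrier H" if "fst ` set w \<subseteq> X" for w
    using that by (induction w) (auto simp: h_def g)
  have h_cons: "h (cons_reduce l w) = g l \<otimes>\<^bsub>H\<^esub> h w" if "fst l \<in> X" "fst ` set w \<subseteq> X" for l w
  proof (cases w)
    case (Cons m w')
    have "h w' = g l \<otimes>\<^bsub>H\<^esub> (g (inv_letter l) \<otimes>\<^bsub>H\<^esub> h w')"
      using that Cons h_closed[of w'] g g_inv[of l] by (simp add: H.m_assoc[symmetric])
    then show ?thesis using Cons by (auto simp: h_def)
  qed (simp add: h_def)
  have h_append: "h (foldr cons_reduce u v) = h u \<otimes>\<^bsub>H\<^esub> h v \<and> fst ` set (foldr cons_reduce u v) \<subseteq> X"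
    if "fst ` set u \<subseteq> X" "fst ` set v \<subseteq> X" for u v
    using that(1)
  proof (induction u)
    case Nil
    then show ?case using that h_closed[of v] by (simp add: h_def)
  next
    case (Cons l u)
    have "h (l # u) = g l \<otimes>\<^bsub>H\<^esub> h u" by (simp add: h_def)
    moreover have "fst ` set (cons_reduce l (foldr cons_reduce u v)) \<subseteq> X"
      using set_cons_reduce[of l "foldr cons_reduce u v"] Cons by fastforce
    ultimately show ?case
      using Cons h_cons[of l "foldr cons_reduce u v"] h_closed[of u] h_closed[of v] that g[of l]
      by (simp add: H.m_assoc)
  qed
  have h_hom: "h \<in> hom (free_group X) H"
    by (rule homI) (auto simp: free_group_def reduce_append h_append h_closed)
  have h_gen: "\<forall>x\<in>X. h [(x, True)] = f x"
    using f by (auto simp: h_def g_def Pi_iff)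
  have "h' w = h w" if h': "h' \<in> hom (free_group X) H" "\<forall>x\<in>X. h' [(x, True)] = f x"
    and w: "w \<in> carrier (free_group X)" for h' w
    using w
  proof (induction w)
    case Nil
    have "h' \<one>\<^bsub>free_group X\<^esub> = \<one>\<^bsub>H\<^esub>"
      using hom_one[OF h'(1) group_free_group \<open>group H\<close>] .
    then show ?case by (simp add: free_group_def h_def)
  next
    case (Cons l w)
    then have w: "w \<in> carrier (free_group X)" and l: "fst l \<in> X"
      by (auto simp: free_group_def dest: reduced_ConsD)
    have split: "l # w = [l] \<otimes>\<^bsub>free_group X\<^esub> w"
      using Cons.prems w by (simp add: free_group_def reduce_id)
    have lc: "[l] \<in> carrier (free_group X)" using l by (simp add: free_group_def)
    have "h' [l] = g l"
    proof (cases "snd l")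
      case True
      then show ?thesis using l h'(2) by (cases l) (auto simp: g_def)
    next
      case False
      let ?x = "[(fst l, True)]"
      have x: "?x \<in> carrier (free_group X)" using l by (simp add: free_group_def)
      have "[l] \<otimes>\<^bsub>free_group X\<^esub> ?x = \<one>\<^bsub>free_group X\<^esub>"
        using False by (cases l) (simp add: free_group_def reduce_def inv_letter_def)
      then have "h' [l] \<otimes>\<^bsub>H\<^esub> h' ?x = \<one>\<^bsub>H\<^esub>"
        using hom_mult[OF h'(1) lc x] hom_one[OF h'(1) group_free_group \<open>group H\<close>] by simp
      then show ?thesis
        using False l f h'(2) H.inv_equality[of "h' [l]" "h' ?x"] hom_in_carrier[OF h'(1)] lc x
        by (auto simp: g_def Pi_iff)
    qed
    then have "h' (l # w) = g l \<otimes>\<^bsub>H\<^esub> h w"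
      using hom_mult[OF h'(1) lc w] split Cons.IH[OF w] by simp
    then show ?case by (simp add: h_def)
  qed
  then show thesis using that h_hom h_gen by blast
qed

end

theory Submission
  imports Defs
begin

text \<open>
  Label the edge between \<open>w\<close> and \<open>x w\<close> of the left Cayley graph of the free group by the
  generator \<open>x\<close>.  The sets of a partition are the classes of a colouring of the group by the
  generators, and a class of colour \<open>x\<close> is left 3-large if every edge labelled \<open>x\<close> has an end of
  colour \<open>x\<close>.  The graph is a tree, so it is enough to give every vertex other than the root
  \<open>\<one>\<close> the label of the edge that leads towards the root, that is, the generator of its first
  letter: every edge is then taken care of by the end that is further from the root.

  For large sets the same must work on the right, where the last letter plays this part, and a
  rule has to decide for each word which of its two outer letters gives the colour.  The first
  letter is chosen exactly if the word is \<open>balanced\<close>, a parity condition on the length and the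
  signs of the outer letters.  Given \<open>w \<noteq> \<one>\<close> and \<open>x\<close>, look at the words \<open>w\<close>, \<open>x w\<close>, \<open>x\<inverse> w\<close>.  If \<open>w\<close>
  does not begin with \<open>x\<close> or \<open>x\<inverse>\<close>, then \<open>x w\<close> and \<open>x\<inverse> w\<close> differ in the sign of the first letter
  and in nothing else that matters; if it does, then \<open>w\<close> and the longer one of the other two
  differ only in the parity of the length.  In either case there are two words with first generator \<open>x\<close>,
  exactly one of which is balanced (lemma \<open>left_translate\<close>), so one of the three words has colour
  \<open>x\<close>.  The condition is symmetric in the two ends of a word, and it is the unbalanced word
  that serves on the right (lemma \<open>right_translate\<close>).
\<close>

section \<open>Finite largeness and partitions\<close>

lemma card_of_ordLess_natLeq_on:
  assumes "finite F" "card F < n"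
  shows "|F| <o natLeq_on n"
proof (rule ccontr)
  assume "\<not> |F| <o natLeq_on n"
  then have "natLeq_on n \<le>o |F|"
    using not_ordLess_iff_ordLeq[OF natLeq_on_Well_order card_of_Well_order] by blast
  then have "|{x. x < n}| \<le>o |F|"
    using card_of_least[OF natLeq_on_well_order_on] ordLeq_transitive by blast
  then obtain f where "inj_on f {x. x < n}" "f ` {x. x < n} \<subseteq> F"
    using card_of_ordLeq by metis
  then have "card {x. x < n} \<le> card F"
    using card_inj_on_le assms(1) by blast
  then show False using assms(2) by simp
qed

lemma (in group) left_largeI:
  assumes "A \<subseteq> carrier G" "F \<subseteq> carrier G" "finite F" "card F < n"
    and "\<And>w. w \<in> carrier G \<Longrightarrow> \<exists>f\<in>F. f \<otimes> w \<in> A"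
  shows "left_large G (natLeq_on n) A"
proof -
  let ?F = "(\<lambda>f. inv f) ` F"
  have "w \<in> ?F <#> A" if w: "w \<in> carrier G" for w
  proof -
    obtain f where f: "f \<in> F" "f \<otimes> w \<in> A" using assms(5)[OF w] by blast
    moreover have "w = inv f \<otimes> (f \<otimes> w)"
      using f(1) w assms(2) by (simp add: m_assoc[symmetric] subset_iff)
    ultimately show ?thesis unfolding set_mult_def by blast
  qed
  moreover have "?F <#> A \<subseteq> carrier G"
    using assms(1,2) by (intro set_mult_closed) auto
  moreover have "|?F| <o natLeq_on n"
    using assms(3,4) card_image_le[of F "\<lambda>f. inv f"] by (intro card_of_ordLess_natLeq_on) auto
  moreover have "?F \<subseteq> carrier G" using assms(2) by auto
  ultimately show ?thesis using assms(1) unfolding left_large_def by blast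
qed

lemma (in group) right_largeI:
  assumes "A \<subseteq> carrier G" "F \<subseteq> carrier G" "finite F" "card F < n"
    and "\<And>w. w \<in> carrier G \<Longrightarrow> \<exists>f\<in>F. w \<otimes> f \<in> A"
  shows "right_large G (natLeq_on n) A"
proof -
  let ?F = "(\<lambda>f. inv f) ` F"
  have "w \<in> A <#> ?F" if w: "w \<in> carrier G" for w
  proof -
    obtain f where f: "f \<in> F" "w \<otimes> f \<in> A" using assms(5)[OF w] by blast
    moreover have "w = (w \<otimes> f) \<otimes> inv f"
      using f(1) w assms(2) by (simp add: m_assoc subset_iff)
    ultimately show ?thesis unfolding set_mult_def by blast
  qed
  moreover have "A <#> ?F \<subseteq> carrier G"
    using assms(1,2) by (intro set_mult_closed) auto
  moreover have "|?F| <o natLeq_on n"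
    using assms(3,4) card_image_le[of F "\<lambda>f. inv f"] by (intro card_of_ordLess_natLeq_on) auto
  moreover have "?F \<subseteq> carrier G" using assms(2) by auto
  ultimately show ?thesis using assms(1) unfolding right_large_def by blast
qed

lemma partitioned_into_colour_classes:
  assumes onto: "\<chi> ` carrier G = X" and "|X| =o \<kappa>"
    and "\<And>x. x \<in> X \<Longrightarrow> Q {w \<in> carrier G. \<chi> w = x}"
  shows "partitioned_into G \<kappa> Q"
proof -
  let ?class = "\<lambda>x. {w \<in> carrier G. \<chi> w = x}"
  have "inj_on ?class X" using onto by (force simp: inj_on_def)
  then have "|?class ` X| =o |X|"
    using card_of_ordIsoI[of ?class X] ordIso_symmetric by (blast intro: inj_on_imp_bij_betw)
  then have "|?class ` X| =o \<kappa>" using assms(2) by (rule ordIso_transitive)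
  moreover have "partition_on (carrier G) (?class ` X)"
    using onto by (intro partition_onI) (auto simp: disjnt_def)
  ultimately show ?thesis unfolding partitioned_into_def using assms(3) by blast
qed

section \<open>Outer letters of reduced words\<close>

lemma reduced_ConsI: "reduced w \<Longrightarrow> w \<noteq> [] \<Longrightarrow> hd w \<noteq> inv_letter l \<Longrightarrow> reduced (l # w)"
  by (cases w) auto

lemma reduced_snocI:
  assumes "reduced w" "w \<noteq> []" "last w \<noteq> inv_letter l"
  shows "reduced (w @ [l])"
proof -
  have "l \<noteq> inv_letter (last w)" using assms(3) by auto
  moreover have "last w = w ! i" if "Suc i = length w" for i
    using that[symmetric] assms(2) by (simp add: last_conv_nth)
  ultimately show ?thesis
    using assms(1) unfolding reduced_def by (auto simp: nth_append less_Suc_eq)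
qed

lemma free_group_Nil_closed: "[] \<in> carrier (free_group X)"
  by (simp add: free_group_def)

lemma free_group_letter_closed: "fst l \<in> X \<Longrightarrow> [l] \<in> carrier (free_group X)"
  by (simp add: free_group_def)

lemma free_group_Nil_mult:
  "w \<in> carrier (free_group X) \<Longrightarrow> [] \<otimes>\<^bsub>free_group X\<^esub> w = w"
  "w \<in> carrier (free_group X) \<Longrightarrow> w \<otimes>\<^bsub>free_group X\<^esub> [] = w"
  by (simp_all add: free_group_def reduce_id)

lemma free_group_Cons_mult: "reduced (l # w) \<Longrightarrow> [l] \<otimes>\<^bsub>free_group X\<^esub> w = l # w"
  by (simp add: free_group_def reduce_id)

lemma free_group_mult_snoc: "reduced (w @ [l]) \<Longrightarrow> w \<otimes>\<^bsub>free_group X\<^esub> [l] = w @ [l]"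
  by (simp add: free_group_def reduce_id)

section \<open>Colouring words by their outer letters\<close>

text \<open>
  For a nonempty word this says that the length plus the number of positive signs among the two
  outer letters is even.  What counts is that the truth value flips when just one of these three
  data changes, the length by one or either sign, and that the two ends enter symmetrically.
\<close>

definition balanced :: "'a letter list \<Rightarrow> bool" where
  "balanced w \<longleftrightarrow> (even (length w) \<longleftrightarrow> (snd (hd w) \<longleftrightarrow> snd (last w)))"

text \<open>
  The alternative \<open>fst (last v) = x\<close> covers the empty word \<open>w\<close>: its translates \<open>x\<close> and \<open>x\<inverse>\<close> differ
  at both ends at once, so that neither need have the wanted parity, but both of their ends give
  the colour \<open>x\<close>.
\<close>

lemma left_translate:
  assumes w: "w \<in> carrier (free_group X)"
  shows "\<exists>f\<in>{[], [(x, True)], [(x, False)]}. \<exists>v. v = f \<otimes>\<^bsub>free_group X\<^esub> w \<and> v \<noteq> [] \<and>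
    fst (hd v) = x \<and> (balanced v \<or> fst (last v) = x)"
proof -
  have red: "reduced w" using w by (simp add: free_group_def)
  note mult = free_group_Nil_mult(1)[OF w] free_group_Cons_mult
  consider "w = []" | s where "w \<noteq> []" "hd w = (x, s)" | "w \<noteq> []" "fst (hd w) \<noteq> x"
    by (metis prod.collapse)
  then show ?thesis
  proof cases
    case 1
    then show ?thesis by (simp add: mult)
  next
    case (2 s)
    then have "reduced ((x, s) # w)"
      using red by (auto intro!: reduced_ConsI simp: inv_letter_def)
    moreover have "balanced ((x, s) # w) \<noteq> balanced w" using 2 by (auto simp: balanced_def)
    ultimately show ?thesis using 2 by (cases s; cases "balanced w") (simp_all add: mult)
  next
    case 3
    then have "reduced ((x, s) # w)" for s
      using red by (auto intro!: reduced_ConsI simp: inv_letter_def)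
    moreover have "balanced ((x, True) # w) \<noteq> balanced ((x, False) # w)"
      using 3 by (auto simp: balanced_def)
    ultimately show ?thesis by (cases "balanced ((x, True) # w)") (simp_all add: mult)
  qed
qed

lemma right_translate:
  assumes w: "w \<in> carrier (free_group X)"
  shows "\<exists>f\<in>{[], [(x, True)], [(x, False)]}. \<exists>v. v = w \<otimes>\<^bsub>free_group X\<^esub> f \<and> v \<noteq> [] \<and>
    fst (last v) = x \<and> (\<not> balanced v \<or> fst (hd v) = x)"
proof -
  have red: "reduced w" using w by (simp add: free_group_def)
  note mult = free_group_Nil_mult(2)[OF w] free_group_mult_snoc
  consider "w = []" | s where "w \<noteq> []" "last w = (x, s)" | "w \<noteq> []" "fst (last w) \<noteq> x"
    by (metis prod.collapse)
  then show ?thesis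
  proof cases
    case 1
    then show ?thesis by (simp add: mult)
  next
    case (2 s)
    then have "reduced (w @ [(x, s)])"
      using red by (auto intro!: reduced_snocI simp: inv_letter_def)
    moreover have "balanced (w @ [(x, s)]) \<noteq> balanced w" using 2 by (auto simp: balanced_def)
    ultimately show ?thesis using 2 by (cases s; cases "balanced w") (simp_all add: mult)
  next
    case 3
    then have "reduced (w @ [(x, s)])" for s
      using red by (auto intro!: reduced_snocI simp: inv_letter_def)
    moreover have "balanced (w @ [(x, True)]) \<noteq> balanced (w @ [(x, False)])"
      using 3 by (auto simp: balanced_def)
    ultimately show ?thesis by (cases "balanced (w @ [(x, True)])") (simp_all add: mult)
  qed
qed

definition outer_colour :: "('a letter list \<Rightarrow> bool) \<Rightarrow> 'a \<Rightarrow> 'a letter list \<Rightarrow> 'a" where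
  "outer_colour T x\<^sub>0 w = (if w = [] then x\<^sub>0 else if T w then fst (hd w) else fst (last w))"

lemma outer_colour_onto:
  assumes "x\<^sub>0 \<in> X"
  shows "outer_colour T x\<^sub>0 ` carrier (free_group X) = X"
proof
  show "outer_colour T x\<^sub>0 ` carrier (free_group X) \<subseteq> X"
    using assms by (auto simp: outer_colour_def free_group_def)
  show "X \<subseteq> outer_colour T x\<^sub>0 ` carrier (free_group X)"
  proof
    fix x assume "x \<in> X"
    then have "[(x, True)] \<in> carrier (free_group X)" by (simp add: free_group_letter_closed)
    moreover have "outer_colour T x\<^sub>0 [(x, True)] = x" by (simp add: outer_colour_def)
    ultimately show "x \<in> outer_colour T x\<^sub>0 ` carrier (free_group X)" by force
  qed
qed

text \<open>
  With the first letter always giving the colour two translates suffice: \<open>x w\<close> begins with \<open>x\<close>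
  unless \<open>w\<close> begins with \<open>x\<inverse>\<close>, and then \<open>w\<close> itself has the colour \<open>x\<close>.
\<close>

lemma left_large_first_letter_class:
  assumes x: "x \<in> X"
  shows "left_large (free_group X) (natLeq_on 3)
    {w \<in> carrier (free_group X). outer_colour (\<lambda>_. True) x\<^sub>0 w = x}"
proof -
  interpret group "free_group X" by (rule group_free_group)
  let ?A = "{w \<in> carrier (free_group X). outer_colour (\<lambda>_. True) x\<^sub>0 w = x}"
  let ?F = "{[], [(x, True)]}"
  have F: "?F \<subseteq> carrier (free_group X)"
    using x by (simp add: free_group_Nil_closed free_group_letter_closed)
  have "\<exists>f\<in>?F. f \<otimes>\<^bsub>free_group X\<^esub> w \<in> ?A" if w: "w \<in> carrier (free_group X)" for w
  proof (cases "w \<noteq> [] \<and> fst (hd w) = x")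
    case True
    then show ?thesis using w by (simp add: free_group_Nil_mult outer_colour_def)
  next
    case False
    then have "reduced ((x, True) # w)"
      using w by (cases "w = []") (auto intro!: reduced_ConsI simp: inv_letter_def free_group_def)
    then have eq: "[(x, True)] \<otimes>\<^bsub>free_group X\<^esub> w = (x, True) # w" by (rule free_group_Cons_mult)
    have "[(x, True)] \<otimes>\<^bsub>free_group X\<^esub> w \<in> carrier (free_group X)" using F w by simp
    then show ?thesis by (simp add: eq outer_colour_def)
  qed
  then show ?thesis by (intro left_largeI[OF _ F]) auto
qed

lemma large_balanced_class:
  assumes x: "x \<in> X"
  shows "large (free_group X) (natLeq_on 4)
    {w \<in> carrier (free_group X). outer_colour balanced x\<^sub>0 w = x}"
proof -
  interpret group "free_group X" by (rule group_free_group)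
  let ?A = "{w \<in> carrier (free_group X). outer_colour balanced x\<^sub>0 w = x}"
  let ?F = "{[], [(x, True)], [(x, False)]}"
  have F: "?F \<subseteq> carrier (free_group X)"
    using x by (simp add: free_group_Nil_closed free_group_letter_closed)
  have card: "card ?F < 4" by simp
  have left: "\<exists>f\<in>?F. f \<otimes>\<^bsub>free_group X\<^esub> w \<in> ?A" if w: "w \<in> carrier (free_group X)" for w
  proof -
    obtain f where f: "f \<in> ?F" "outer_colour balanced x\<^sub>0 (f \<otimes>\<^bsub>free_group X\<^esub> w) = x"
      using left_translate[OF w, of x] unfolding outer_colour_def by metis
    then have "f \<otimes>\<^bsub>free_group X\<^esub> w \<in> carrier (free_group X)" using F w by blast
    then show ?thesis using f by blast
  qed
  have right: "\<exists>f\<in>?F. w \<otimes>\<^bsub>free_group X\<^esub> f \<in> ?A" if w: "w \<in> carrier (free_group X)" for w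
  proof -
    obtain f where f: "f \<in> ?F" "outer_colour balanced x\<^sub>0 (w \<otimes>\<^bsub>free_group X\<^esub> f) = x"
      using right_translate[OF w, of x] unfolding outer_colour_def by metis
    then have "w \<otimes>\<^bsub>free_group X\<^esub> f \<in> carrier (free_group X)" using F w by blast
    then show ?thesis using f by blast
  qed
  show ?thesis unfolding large_def
    using left_largeI[OF _ F _ card left] right_largeI[OF _ F _ card right] by simp
qed

theorem theorem3p1:
  fixes \<kappa> :: "'k rel" and X :: "'a set"
  assumes "Card_order \<kappa>" and "cinfinite \<kappa>" and "|X| =o \<kappa>"
  shows "partitioned_into (free_group X) \<kappa> (left_large (free_group X) (natLeq_on 3))
    \<and> partitioned_into (free_group X) \<kappa> (large (free_group X) (natLeq_on 4))"
proof -
  have "|X| =o |Field \<kappa>|"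
    using ordIso_transitive[OF assms(3) ordIso_symmetric[OF card_of_Field_ordIso[OF assms(1)]]] .
  then have "infinite X"
    using assms(2) by (simp add: cinfinite_def card_of_ordIso_finite)
  then obtain x\<^sub>0 where x\<^sub>0: "x\<^sub>0 \<in> X" using infinite_imp_nonempty by blast
  note partition = partitioned_into_colour_classes[OF outer_colour_onto[OF x\<^sub>0] assms(3)]
  show ?thesis
  proof
    show "partitioned_into (free_group X) \<kappa> (left_large (free_group X) (natLeq_on 3))"
      by (rule partition) (rule left_large_first_letter_class)
    show "partitioned_into (free_group X) \<kappa> (large (free_group X) (natLeq_on 4))"
      by (rule partition) (rule large_balanced_class)
  qed
qed

end
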